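(* Let $D\subset\mathbb{R}^d$ be a nonempty bounded open set, let $f\colon L^2(D)\to\mathbb{R}$ be continuously differentiable, let $x_a,x_b\in L^2(D)$ satisfy $x_a(\omega)<0<x_b(\omega)$ for almost every $\omega\in D$, and put $$\varphi(x):=\boldsymbol\lambda(\{x\ne0\})\quad(x\in L^2(D)),\qquad \Omega:=\{x\in L^2(D)\mid x_a\le x\le x_b\text{ a.e. on }D\}.$$ Let $\bar x\in L^2(D)$ be a local minimum of the problem $\min\{f(x)+\varphi(x)\mid x\in\Omega\}$. Then, for each $\varepsilon>0$, there exist a slowly decreasing function $x_1\in B_\varepsilon(\bar x)$, some $x_2\in\Omega\cap B_\varepsilon(\bar x)$ and $x_1^*,x_2^*\in L^2(D)$ such that $$\|f'(x_2)+x_1^*+x_2^*\|<\varepsilon,\qquad|\varphi(x_1)-\varphi(\bar x)|<\varepsilon,\qquad\{x_1^*\ne0\}\subset\{x_1=0\},$$ $$x_2^*\ge0\ \text{ a.e. on }\{x_2>x_a\},\qquad x_2^*\le0\ \text{ a.e. on }\{x_2<x_b\}.$$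
   Context: $\boldsymbol\lambda$ is Lebesgue measure on $D$; $L^2(D)$ is the usual Lebesgue space with its usual norm, and its dual is identified with $L^2(D)$, so $f'(x)\in L^2(D)$. For $x\in L^2(D)$, $\{x\ne0\}:=\{\omega\in D\mid x(\omega)\ne0\}$, and $\{x=0\}$, $\{x>x_a\}$, etc. are defined analogously; these sets are determined up to null sets, and inclusions between them are understood up to null sets. $B_\varepsilon(\bar x)$ is the open ball in $L^2(D)$. A function $x\in L^2(D)$ is called slowly decreasing if $\lim_{t\downarrow0}\boldsymbol\lambda(\{0<|x|\le t\})/t^2=0$. *)

theory Defs
  imports "HOL-Analysis.Analysis"
begin

text \<open>
  The space \<open>L\<^sup>2(M)\<close> is represented by the square-integrable functions themselves, not by their
  classes modulo null sets.  Accordingly \<open>L2_norm\<close> is only a seminorm, and every pointwise condition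
  below is meant almost everywhere.
\<close>

definition L2 :: "'a measure \<Rightarrow> ('a \<Rightarrow> real) set" where
  "L2 M = {x \<in> borel_measurable M. integrable M (\<lambda>\<omega>. (x \<omega>)\<^sup>2)}"

definition L2_inner :: "'a measure \<Rightarrow> ('a \<Rightarrow> real) \<Rightarrow> ('a \<Rightarrow> real) \<Rightarrow> real" where
  "L2_inner M x y = (LINT \<omega>|M. x \<omega> * y \<omega>)"

definition L2_norm :: "'a measure \<Rightarrow> ('a \<Rightarrow> real) \<Rightarrow> real" where
  "L2_norm M x = sqrt (LINT \<omega>|M. (x \<omega>)\<^sup>2)"

definition L2_ball :: "'a measure \<Rightarrow> ('a \<Rightarrow> real) \<Rightarrow> real \<Rightarrow> ('a \<Rightarrow> real) set" where
  "L2_ball M x r = {y \<in> L2 M. L2_norm M (\<lambda>\<omega>. y \<omega> - x \<omega>) < r}"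

text \<open>
  Frechet differentiability at \<open>x\<close>, with the derivative \<open>g\<close> regarded as an element of \<open>L\<^sup>2(M)\<close>
  through the Riesz identification of the dual.
\<close>

definition has_L2_derivative ::
    "'a measure \<Rightarrow> (('a \<Rightarrow> real) \<Rightarrow> real) \<Rightarrow> ('a \<Rightarrow> real) \<Rightarrow> ('a \<Rightarrow> real) \<Rightarrow> bool" where
  "has_L2_derivative M f g x \<longleftrightarrow> g \<in> L2 M \<and>
     (\<forall>e>0. \<exists>\<delta>>0. \<forall>h\<in>L2 M. L2_norm M h < \<delta> \<longrightarrow>
        \<bar>f (\<lambda>\<omega>. x \<omega> + h \<omega>) - f x - L2_inner M g h\<bar> \<le> e * L2_norm M h)"

text \<open>
  Continuous differentiability on all of \<open>L\<^sup>2(M)\<close>.  It implies that \<open>f\<close> takes equal values at functions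
  that agree almost everywhere (lemma \<open>continuously_L2_differentiable_cong_AE\<close>), so that \<open>f\<close> is
  a function on the classes; the same holds for \<open>f'\<close>, up to null sets, by its continuity.
\<close>

definition continuously_L2_differentiable ::
    "'a measure \<Rightarrow> (('a \<Rightarrow> real) \<Rightarrow> real) \<Rightarrow> (('a \<Rightarrow> real) \<Rightarrow> ('a \<Rightarrow> real)) \<Rightarrow> bool" where
  "continuously_L2_differentiable M f f' \<longleftrightarrow>
     (\<forall>x\<in>L2 M. has_L2_derivative M f (f' x) x) \<and>
     (\<forall>x\<in>L2 M. \<forall>e>0. \<exists>\<delta>>0. \<forall>y\<in>L2_ball M x \<delta>. L2_norm M (\<lambda>\<omega>. f' y \<omega> - f' x \<omega>) < e)"

lemma continuously_L2_differentiable_cong_AE: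
  assumes f: "continuously_L2_differentiable M f f'"
    and x: "x \<in> L2 M" and y: "y \<in> L2 M" and ae: "AE \<omega> in M. x \<omega> = y \<omega>"
  shows "f x = f y"
proof -
  define h where "h = (\<lambda>\<omega>. y \<omega> - x \<omega>)"
  have h_meas: "h \<in> borel_measurable M"
    using x y by (auto simp: h_def L2_def)
  have h0: "AE \<omega> in M. h \<omega> = 0"
    using ae by (auto simp: h_def)
  have sq0: "AE \<omega> in M. (h \<omega>)\<^sup>2 = 0"
    using h0 by auto
  have "integrable M (\<lambda>\<omega>. (h \<omega>)\<^sup>2) \<longleftrightarrow> integrable M (\<lambda>\<omega>. 0 :: real)"
    using h_meas sq0 by (intro integrable_cong_AE) auto
  then have hL2: "h \<in> L2 M"
    using h_meas by (simp add: L2_def)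
  have "(LINT \<omega>|M. (h \<omega>)\<^sup>2) = 0"
    using sq0 by (rule integral_eq_zero_AE)
  then have norm0: "L2_norm M h = 0"
    by (simp add: L2_norm_def)
  have inner0: "L2_inner M (f' x) h = 0"
    unfolding L2_inner_def using h0 by (intro integral_eq_zero_AE) auto
  have "has_L2_derivative M f (f' x) x"
    using f x by (simp add: continuously_L2_differentiable_def)
  then obtain \<delta> where "\<delta> > 0" and
    \<delta>: "\<And>h. h \<in> L2 M \<Longrightarrow> L2_norm M h < \<delta> \<Longrightarrow>
      \<bar>f (\<lambda>\<omega>. x \<omega> + h \<omega>) - f x - L2_inner M (f' x) h\<bar> \<le> 1 * L2_norm M h"
    unfolding has_L2_derivative_def by (meson zero_less_one)
  have "\<bar>f (\<lambda>\<omega>. x \<omega> + h \<omega>) - f x\<bar> \<le> 0"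
    using \<delta>[OF hL2] norm0 inner0 \<open>\<delta> > 0\<close> by simp
  then show ?thesis
    by (simp add: h_def)
qed

text \<open>Total in \<open>M\<close>, but meaningful for finite \<open>M\<close> only, since \<open>measure\<close> sends infinite values to 0.\<close>

definition support_measure :: "'a measure \<Rightarrow> ('a \<Rightarrow> real) \<Rightarrow> real" where
  "support_measure M x = measure M {\<omega> \<in> space M. x \<omega> \<noteq> 0}"

definition box_constraint :: "'a measure \<Rightarrow> ('a \<Rightarrow> real) \<Rightarrow> ('a \<Rightarrow> real) \<Rightarrow> ('a \<Rightarrow> real) set" where
  "box_constraint M xa xb = {x \<in> L2 M. AE \<omega> in M. xa \<omega> \<le> x \<omega> \<and> x \<omega> \<le> xb \<omega>}"

definition L2_local_min_on ::
    "'a measure \<Rightarrow> (('a \<Rightarrow> real) \<Rightarrow> real) \<Rightarrow> ('a \<Rightarrow> real) set \<Rightarrow> ('a \<Rightarrow> real) \<Rightarrow> bool" where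
  "L2_local_min_on M F S x \<longleftrightarrow> x \<in> S \<and> (\<exists>r>0. \<forall>y \<in> S \<inter> L2_ball M x r. F x \<le> F y)"

definition slowly_decreasing :: "'a measure \<Rightarrow> ('a \<Rightarrow> real) \<Rightarrow> bool" where
  "slowly_decreasing M x \<longleftrightarrow> x \<in> L2 M \<and>
     ((\<lambda>t. measure M {\<omega> \<in> space M. 0 < \<bar>x \<omega>\<bar> \<and> \<bar>x \<omega>\<bar> \<le> t} / t\<^sup>2) \<longlongrightarrow> 0) (at_right 0)"

end

theory Submission
  imports Defs
begin

text \<open>
  At a local minimum \<open>x'\<close> the asserted conditions hold with \<open>x2 = x'\<close> and with zero residual,
  because \<open>\<phi>\<close> does not react to the variations that matter. Moving \<open>x'\<close> only within its own support
  cannot increase \<open>\<phi>\<close>, so \<open>f\<close> alone has nonnegative slope in every feasible direction that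
  vanishes where \<open>x'\<close> does (\<open>variational_inequality_on_support\<close>). Testing this with a function that
  jumps to the bound in the direction of steepest descent shows that, on \<open>{x' \<noteq> 0}\<close>, the negative
  gradient is normal to the box: where \<open>f' x'\<close> is positive \<open>x'\<close> sits on the lower bound, where it is
  negative \<open>x'\<close> sits on the upper bound (\<open>local_min_at_bounds_on_support\<close>).

  Hence \<open>- f' x'\<close> splits along the support of \<open>x'\<close>: the part on \<open>{x' \<noteq> 0}\<close> is the normal \<open>x2s\<close> of
  the box, and the part on \<open>{x' = 0}\<close> is \<open>x1s\<close>. Since \<open>x'\<close> itself need not be slowly decreasing, \<open>x1\<close>
  is obtained by cutting off its small values (\<open>slowly_decreasing_approximation\<close>). That
  enlarges the zero set, so the support condition on \<open>x1s\<close> survives.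
\<close>

section \<open>Square-integrable functions\<close>

lemma L2_dominated:
  assumes h: "h \<in> L2 M" and y: "y \<in> borel_measurable M"
    and le: "\<And>\<omega>. \<bar>y \<omega>\<bar> \<le> \<bar>h \<omega>\<bar>"
  shows "y \<in> L2 M"
proof -
  have sq: "(y \<omega>)\<^sup>2 \<le> (h \<omega>)\<^sup>2" for \<omega>
    using le[of \<omega>] by (rule abs_le_square_iff[THEN iffD1])
  have "integrable M (\<lambda>\<omega>. (y \<omega>)\<^sup>2)"
    by (rule Bochner_Integration.integrable_bound[where f="\<lambda>\<omega>. (h \<omega>)\<^sup>2"])
      (use h y sq in \<open>auto simp: L2_def\<close>)
  then show ?thesis using y by (simp add: L2_def)
qed

lemma L2_scale: "y \<in> L2 M \<Longrightarrow> (\<lambda>\<omega>. c * y \<omega>) \<in> L2 M"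
  by (auto simp: L2_def power_mult_distrib)

lemma L2_add:
  assumes x: "x \<in> L2 M" and y: "y \<in> L2 M"
  shows "(\<lambda>\<omega>. x \<omega> + y \<omega>) \<in> L2 M"
proof -
  have sq: "(a + b)\<^sup>2 \<le> 2 * a\<^sup>2 + 2 * b\<^sup>2" for a b :: real
    using zero_le_power2[of "a - b"] by (simp add: power2_eq_square algebra_simps)
  have "integrable M (\<lambda>\<omega>. (x \<omega> + y \<omega>)\<^sup>2)"
    by (rule Bochner_Integration.integrable_bound[where f="\<lambda>\<omega>. 2 * (x \<omega>)\<^sup>2 + 2 * (y \<omega>)\<^sup>2"])
      (use x y sq in \<open>auto simp: L2_def\<close>)
  then show ?thesis using x y by (auto simp: L2_def)
qed

lemma L2_diff: "x \<in> L2 M \<Longrightarrow> y \<in> L2 M \<Longrightarrow> (\<lambda>\<omega>. x \<omega> - y \<omega>) \<in> L2 M"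
  using L2_add[of x M "\<lambda>\<omega>. - 1 * y \<omega>"] L2_scale[of y M "- 1"] by simp

lemma L2_mult_integrable:
  assumes "x \<in> L2 M" and "y \<in> L2 M"
  shows "integrable M (\<lambda>\<omega>. x \<omega> * y \<omega>)"
proof -
  have prod: "\<bar>a * b\<bar> \<le> a\<^sup>2 + b\<^sup>2" for a b :: real
  proof -
    have "2 * (\<bar>a\<bar> * \<bar>b\<bar>) \<le> a\<^sup>2 + b\<^sup>2"
      using zero_le_power2[of "\<bar>a\<bar> - \<bar>b\<bar>"] by (simp add: power2_diff)
    moreover have "0 \<le> \<bar>a\<bar> * \<bar>b\<bar>" by simp
    ultimately show ?thesis unfolding abs_mult by linarith
  qed
  show ?thesis
    by (rule Bochner_Integration.integrable_bound[where f="\<lambda>\<omega>. (x \<omega>)\<^sup>2 + (y \<omega>)\<^sup>2"])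
      (use assms prod in \<open>auto simp: L2_def\<close>)
qed

lemma L2_norm_scale: "L2_norm M (\<lambda>\<omega>. c * y \<omega>) = \<bar>c\<bar> * L2_norm M y"
  by (simp add: L2_norm_def power_mult_distrib real_sqrt_mult)

lemma L2_norm_nonneg: "0 \<le> L2_norm M y"
  by (simp add: L2_norm_def)

lemma L2_inner_scale: "L2_inner M g (\<lambda>\<omega>. c * y \<omega>) = c * L2_inner M g y"
  by (simp add: L2_inner_def mult.left_commute)

lemma box_constraint_convex_combination:
  assumes x: "x \<in> box_constraint M xa xb" and y: "y \<in> box_constraint M xa xb"
    and t: "0 \<le> t" "t \<le> 1"
  shows "(\<lambda>\<omega>. x \<omega> + t * (y \<omega> - x \<omega>)) \<in> box_constraint M xa xb"
proof -
  have "a \<le> u + t * (v - u) \<and> u + t * (v - u) \<le> b"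
    if "a \<le> u \<and> u \<le> b" "a \<le> v \<and> v \<le> b" for a b u v :: real
  proof -
    have "u + t * (v - u) = (1 - t) * u + t * v" by (simp add: algebra_simps)
    moreover have "(1 - t) * u + t * v \<le> b"
      using that t by (intro convex_bound_le) auto
    moreover have "(1 - t) * (- u) + t * (- v) \<le> - a"
      using that t by (intro convex_bound_le) auto
    ultimately show ?thesis by linarith
  qed
  moreover have "AE \<omega> in M. xa \<omega> \<le> x \<omega> \<and> x \<omega> \<le> xb \<omega>" "AE \<omega> in M. xa \<omega> \<le> y \<omega> \<and> y \<omega> \<le> xb \<omega>"
    using x y by (auto simp: box_constraint_def)
  ultimately have "AE \<omega> in M. xa \<omega> \<le> x \<omega> + t * (y \<omega> - x \<omega>) \<and> x \<omega> + t * (y \<omega> - x \<omega>) \<le> xb \<omega>"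
    by (auto elim!: eventually_elim2)
  moreover have "(\<lambda>\<omega>. x \<omega> + t * (y \<omega> - x \<omega>)) \<in> L2 M"
    using x y by (intro L2_add L2_scale L2_diff) (auto simp: box_constraint_def)
  ultimately show ?thesis by (simp add: box_constraint_def)
qed

section \<open>First-order conditions on the support of a local minimum\<close>

lemma (in finite_measure) support_measure_mono:
  assumes "x \<in> borel_measurable M" and "\<And>\<omega>. x \<omega> = 0 \<Longrightarrow> y \<omega> = 0"
  shows "support_measure M y \<le> support_measure M x"
  unfolding support_measure_def using assms by (intro finite_measure_mono) auto

text \<open>
  Along the segment from \<open>x\<close> to \<open>y\<close> the support stays inside that of \<open>x\<close>. So the support term can
  only decrease and minimality bounds \<open>f\<close> itself from below by \<open>f x\<close>.
\<close>

lemma (in finite_measure) variational_inequality_on_support: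
  assumes der: "has_L2_derivative M f g x"
    and min: "L2_local_min_on M (\<lambda>z. f z + support_measure M z) (box_constraint M xa xb) x"
    and y: "y \<in> box_constraint M xa xb"
    and supp: "\<And>\<omega>. x \<omega> = 0 \<Longrightarrow> y \<omega> = 0"
  shows "0 \<le> L2_inner M g (\<lambda>\<omega>. y \<omega> - x \<omega>)"
proof (rule ccontr)
  define h where "h = (\<lambda>\<omega>. y \<omega> - x \<omega>)"
  define c where "c = L2_inner M g h"
  define N where "N = L2_norm M h"
  assume "\<not> 0 \<le> L2_inner M g (\<lambda>\<omega>. y \<omega> - x \<omega>)"
  then have c: "c < 0" by (simp add: c_def h_def)
  have N: "N \<ge> 0" by (simp add: N_def L2_norm_nonneg)
  from min obtain r where x: "x \<in> box_constraint M xa xb" and r: "r > 0"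
    and min_r: "\<And>z. z \<in> box_constraint M xa xb \<Longrightarrow> z \<in> L2_ball M x r \<Longrightarrow>
      f x + support_measure M x \<le> f z + support_measure M z"
    by (auto simp: L2_local_min_on_def)
  have xL: "x \<in> L2 M" and hL: "h \<in> L2 M"
    using x y by (auto simp: box_constraint_def h_def intro: L2_diff)
  \<comment> \<open>an error slope strictly below \<open>- c / N\<close>, where adding 1 to \<open>N\<close> covers \<open>N = 0\<close>\<close>
  define e where "e = - c / (N + 1)"
  have e: "e > 0" using c N by (simp add: e_def divide_neg_pos)
  have "e * (N + 1) = - c" using N by (simp add: e_def)
  then have eN: "e * N < - c" using e by (simp add: algebra_simps)
  from der e obtain \<delta> where \<delta>: "\<delta> > 0"
    and approx: "\<And>k. k \<in> L2 M \<Longrightarrow> L2_norm M k < \<delta> \<Longrightarrow>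
      \<bar>f (\<lambda>\<omega>. x \<omega> + k \<omega>) - f x - L2_inner M g k\<bar> \<le> e * L2_norm M k"
    unfolding has_L2_derivative_def by meson
  define m where "m = min \<delta> r"
  define t where "t = min 1 (m / (N + 1))"
  have m: "m > 0" using \<delta> r by (simp add: m_def)
  have t: "0 < t" "t \<le> 1" using m N by (auto simp: t_def)
  have "t \<le> m / (N + 1)" by (simp add: t_def)
  then have "t * (N + 1) \<le> m" using N by (simp add: pos_le_divide_eq)
  then have tN: "t * N < m" using t by (simp add: algebra_simps)
  define k where "k = (\<lambda>\<omega>. t * h \<omega>)"
  have k_norm: "L2_norm M k = t * N"
    using t by (simp add: k_def L2_norm_scale N_def)
  have kL: "k \<in> L2 M" unfolding k_def using hL by (rule L2_scale)
  define z where "z = (\<lambda>\<omega>. x \<omega> + k \<omega>)"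
  have "z \<in> box_constraint M xa xb"
    using box_constraint_convex_combination[OF x y, of t] t by (simp add: z_def k_def h_def)
  moreover have "z \<in> L2_ball M x r"
    using tN k_norm xL kL by (auto simp: L2_ball_def z_def m_def intro: L2_add)
  ultimately have "f x + support_measure M x \<le> f z + support_measure M z"
    by (rule min_r)
  moreover have "support_measure M z \<le> support_measure M x"
    using xL supp by (intro support_measure_mono) (auto simp: L2_def z_def k_def h_def)
  ultimately have "f x \<le> f z" by simp
  moreover have "\<bar>f z - f x - t * c\<bar> \<le> e * (t * N)"
    using approx[OF kL] tN k_norm by (simp add: z_def m_def c_def k_def L2_inner_scale)
  ultimately have "t * (- c) \<le> t * (e * N)" by (simp add: algebra_simps)
  moreover have "t * (e * N) < t * (- c)"
    using eN t by (intro mult_strict_left_mono) auto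
  ultimately show False by simp
qed

text \<open>
  The test function \<open>y\<close> minimises the linearised objective over the box pointwise on the support of \<open>x\<close>.
  Hence \<open>g * (y - x)\<close> is nonpositive, and as its integral is nonnegative it vanishes.
\<close>

lemma (in finite_measure) local_min_at_bounds_on_support:
  assumes der: "has_L2_derivative M f g x"
    and min: "L2_local_min_on M (\<lambda>z. f z + support_measure M z) (box_constraint M xa xb) x"
    and xa: "xa \<in> L2 M" and xb: "xb \<in> L2 M"
  shows "AE \<omega> in M. x \<omega> \<noteq> 0 \<longrightarrow> (g \<omega> > 0 \<longrightarrow> x \<omega> = xa \<omega>) \<and> (g \<omega> < 0 \<longrightarrow> x \<omega> = xb \<omega>)"
proof -
  have x: "x \<in> box_constraint M xa xb" using min by (simp add: L2_local_min_on_def)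
  then have xL: "x \<in> L2 M" and xbox: "AE \<omega> in M. xa \<omega> \<le> x \<omega> \<and> x \<omega> \<le> xb \<omega>"
    by (auto simp: box_constraint_def)
  have gL: "g \<in> L2 M" using der by (simp add: has_L2_derivative_def)
  have [measurable]: "x \<in> borel_measurable M" "g \<in> borel_measurable M"
      "xa \<in> borel_measurable M" "xb \<in> borel_measurable M"
    using xL gL xa xb by (simp_all add: L2_def)
  define y where "y = (\<lambda>\<omega>. if x \<omega> = 0 then 0 else if g \<omega> > 0 then xa \<omega>
    else if g \<omega> < 0 then xb \<omega> else x \<omega>)"
  have abs_L2: "(\<lambda>\<omega>. \<bar>u \<omega>\<bar>) \<in> L2 M" if "u \<in> L2 M" for u
    using that by (intro L2_dominated[OF that]) (auto simp: L2_def)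
  have "y \<in> L2 M"
  proof (rule L2_dominated)
    show "(\<lambda>\<omega>. \<bar>x \<omega>\<bar> + (\<bar>xa \<omega>\<bar> + \<bar>xb \<omega>\<bar>)) \<in> L2 M"
      by (intro L2_add abs_L2 xL xa xb)
    show "y \<in> borel_measurable M" unfolding y_def by measurable
  qed (auto simp: y_def)
  moreover have "AE \<omega> in M. xa \<omega> \<le> y \<omega> \<and> y \<omega> \<le> xb \<omega>"
    using xbox by eventually_elim (auto simp: y_def)
  ultimately have y: "y \<in> box_constraint M xa xb" by (simp add: box_constraint_def)
  define q where "q = (\<lambda>\<omega>. g \<omega> * (y \<omega> - x \<omega>))"
  have q_int: "integrable M q"
    unfolding q_def using gL \<open>y \<in> L2 M\<close> xL by (intro L2_mult_integrable L2_diff)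
  have q_nonpos: "AE \<omega> in M. q \<omega> \<le> 0"
    using xbox by eventually_elim (auto simp: q_def y_def mult_nonneg_nonpos mult_nonpos_nonneg)
  have "0 \<le> integral\<^sup>L M q"
    using variational_inequality_on_support[OF der min y]
    by (simp add: q_def L2_inner_def y_def)
  moreover have "integral\<^sup>L M q \<le> 0"
    using q_nonpos integral_nonneg_AE[where M=M and f="\<lambda>\<omega>. - q \<omega>"] by simp
  ultimately have "integral\<^sup>L M (\<lambda>\<omega>. - q \<omega>) = 0" by simp
  then have "AE \<omega> in M. - q \<omega> = 0"
    by (subst (asm) integral_nonneg_eq_0_iff_AE) (use q_int q_nonpos in auto)
  then show ?thesis
    by eventually_elim (auto simp: q_def y_def)
qed

section \<open>Approximation by slowly decreasing functions\<close>

text \<open>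
  Cutting off all values of modulus at most \<open>s\<close> leaves a function without small nonzero values. It
  changes \<open>x\<close> by at most \<open>s\<close> in modulus, and the support that is lost shrinks to the empty set with \<open>s\<close>.
\<close>

lemma (in finite_measure) slowly_decreasing_approximation:
  assumes x: "x \<in> L2 M" and \<epsilon>: "\<epsilon> > 0"
  obtains x1 where "slowly_decreasing M x1" "x1 \<in> L2_ball M x \<epsilon>"
    "\<bar>support_measure M x1 - support_measure M x\<bar> < \<epsilon>" "\<And>\<omega>. x \<omega> = 0 \<Longrightarrow> x1 \<omega> = 0"
proof -
  have [measurable]: "x \<in> borel_measurable M" using x by (simp add: L2_def)
  define s where "s n = inverse (real (Suc n))" for n
  have s_pos: "s n > 0" for n by (simp add: s_def)
  have s_lim: "s \<longlonglongrightarrow> 0" unfolding s_def by (rule LIMSEQ_inverse_real_of_nat)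
  define u where "u n = (\<lambda>\<omega>. if \<bar>x \<omega>\<bar> > s n then x \<omega> else 0)" for n
  have [measurable]: "u n \<in> borel_measurable M" for n unfolding u_def by measurable
  have uL: "u n \<in> L2 M" for n
    by (rule L2_dominated[OF x]) (auto simp: u_def)
  have slow: "slowly_decreasing M (u n)" for n
  proof -
    have "\<forall>\<^sub>F t in at_right 0. measure M {\<omega> \<in> space M. 0 < \<bar>u n \<omega>\<bar> \<and> \<bar>u n \<omega>\<bar> \<le> t} / t\<^sup>2 = 0"
      using eventually_at_right_real[OF s_pos[of n]]
    proof eventually_elim
      case (elim t)
      then have empty: "{\<omega> \<in> space M. 0 < \<bar>u n \<omega>\<bar> \<and> \<bar>u n \<omega>\<bar> \<le> t} = {}"
        by (auto simp: u_def split: if_splits)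
      show ?case unfolding empty by simp
    qed
    then show ?thesis
      unfolding slowly_decreasing_def using uL by (auto intro: tendsto_eventually)
  qed
  have norm_le: "L2_norm M (\<lambda>\<omega>. u n \<omega> - x \<omega>) \<le> s n * sqrt (measure M (space M))" for n
  proof -
    have "(LINT \<omega>|M. (u n \<omega> - x \<omega>)\<^sup>2) \<le> (LINT \<omega>|M. (s n)\<^sup>2)"
    proof (rule integral_mono)
      show "integrable M (\<lambda>\<omega>. (u n \<omega> - x \<omega>)\<^sup>2)"
        using L2_diff[OF uL x] by (simp add: L2_def)
      show "(u n \<omega> - x \<omega>)\<^sup>2 \<le> (s n)\<^sup>2" for \<omega>
        using s_pos[of n] by (intro abs_le_square_iff[THEN iffD1]) (auto simp: u_def)
    qed auto
    then have "L2_norm M (\<lambda>\<omega>. u n \<omega> - x \<omega>) \<le> sqrt ((s n)\<^sup>2 * measure M (space M))"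
      by (simp add: L2_norm_def mult.commute)
    then show ?thesis using s_pos[of n] by (simp add: real_sqrt_mult)
  qed
  have "(\<lambda>n. s n * sqrt (measure M (space M))) \<longlonglongrightarrow> 0"
    using tendsto_mult_left_zero[OF s_lim] .
  then have ev_norm: "\<forall>\<^sub>F n in sequentially. s n * sqrt (measure M (space M)) < \<epsilon>"
    using \<epsilon> by (rule order_tendstoD)
  define A where "A n = {\<omega> \<in> space M. \<bar>x \<omega>\<bar> > s n}" for n
  have "(\<lambda>n. measure M (A n)) \<longlonglongrightarrow> measure M (\<Union>n. A n)"
  proof (rule finite_Lim_measure_incseq)
    show "range A \<subseteq> sets M" by (auto simp: A_def)
    show "incseq A"
    proof (rule incseq_SucI)
      fix n
      have "s (Suc n) \<le> s n" by (simp add: s_def field_simps)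
      then show "A n \<subseteq> A (Suc n)" by (auto simp: A_def)
    qed
  qed
  moreover have "(\<Union>n. A n) = {\<omega> \<in> space M. x \<omega> \<noteq> 0}"
  proof (intro set_eqI iffI)
    fix \<omega> assume \<omega>: "\<omega> \<in> {\<omega> \<in> space M. x \<omega> \<noteq> 0}"
    then obtain n where "s n < \<bar>x \<omega>\<bar>"
      using reals_Archimedean[of "\<bar>x \<omega>\<bar>"] by (auto simp: s_def)
    with \<omega> show "\<omega> \<in> (\<Union>n. A n)" by (auto simp: A_def)
  next
    fix \<omega> assume "\<omega> \<in> (\<Union>n. A n)"
    then show "\<omega> \<in> {\<omega> \<in> space M. x \<omega> \<noteq> 0}"
      using s_pos by (auto simp: A_def dest: less_asym)
  qed
  moreover have "support_measure M (u n) = measure M (A n)" for n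
  proof -
    have "{\<omega> \<in> space M. u n \<omega> \<noteq> 0} = A n"
      using s_pos[of n] by (auto simp: A_def u_def)
    then show ?thesis by (simp add: support_measure_def)
  qed
  ultimately have "(\<lambda>n. support_measure M (u n)) \<longlonglongrightarrow> support_measure M x"
    by (simp add: support_measure_def[of M x])
  then have "\<forall>\<^sub>F n in sequentially. \<bar>support_measure M (u n) - support_measure M x\<bar> < \<epsilon>"
    using \<epsilon> by (auto dest: tendstoD simp: dist_real_def)
  with ev_norm obtain n where "s n * sqrt (measure M (space M)) < \<epsilon>"
    and close: "\<bar>support_measure M (u n) - support_measure M x\<bar> < \<epsilon>"
    by (metis (mono_tags, lifting) eventually_conj eventually_sequentially order_refl)
  then have "u n \<in> L2_ball M x \<epsilon>"
    using norm_le[of n] uL by (auto simp: L2_ball_def)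
  with slow close show thesis by (intro that[of "u n"]) (auto simp: u_def)
qed

section \<open>The approximate optimality conditions\<close>

theorem theorem8p3:
  fixes D :: "(real ^ 'd) set"
    and f :: "(real ^ 'd \<Rightarrow> real) \<Rightarrow> real"
    and f' :: "(real ^ 'd \<Rightarrow> real) \<Rightarrow> (real ^ 'd \<Rightarrow> real)"
    and x\<^sub>a x\<^sub>b x' :: "real ^ 'd \<Rightarrow> real"
  defines "M \<equiv> lebesgue_on D"
  defines "\<phi> \<equiv> support_measure M"
  defines "\<Omega> \<equiv> box_constraint M x\<^sub>a x\<^sub>b"
  assumes "D \<noteq> {}" and "bounded D" and "open D"
    and "continuously_L2_differentiable M f f'"
    and "x\<^sub>a \<in> L2 M" and "x\<^sub>b \<in> L2 M"
    and "AE \<omega> in M. x\<^sub>a \<omega> < 0 \<and> 0 < x\<^sub>b \<omega>"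
    and "x' \<in> L2 M"
    and "L2_local_min_on M (\<lambda>x. f x + \<phi> x) \<Omega> x'"
  shows "\<forall>\<epsilon>>0. \<exists>x1 x2 x1s x2s.
      slowly_decreasing M x1 \<and> x1 \<in> L2_ball M x' \<epsilon> \<and>
      x2 \<in> \<Omega> \<inter> L2_ball M x' \<epsilon> \<and>
      x1s \<in> L2 M \<and> x2s \<in> L2 M \<and>
      L2_norm M (\<lambda>\<omega>. f' x2 \<omega> + x1s \<omega> + x2s \<omega>) < \<epsilon> \<and>
      \<bar>\<phi> x1 - \<phi> x'\<bar> < \<epsilon> \<and>
      (AE \<omega> in M. x1s \<omega> \<noteq> 0 \<longrightarrow> x1 \<omega> = 0) \<and>
      (AE \<omega> in M. x2 \<omega> > x\<^sub>a \<omega> \<longrightarrow> x2s \<omega> \<ge> 0) \<and>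
      (AE \<omega> in M. x2 \<omega> < x\<^sub>b \<omega> \<longrightarrow> x2s \<omega> \<le> 0)"
proof (intro allI impI)
  fix \<epsilon> :: real
  assume \<epsilon>: "\<epsilon> > 0"
  interpret finite_measure M
    unfolding M_def using \<open>bounded D\<close> \<open>open D\<close>
    by (intro finite_measure_lebesgue_on bounded_set_imp_lmeasurable) auto
  have der: "has_L2_derivative M f (f' x') x'"
    using assms by (simp add: continuously_L2_differentiable_def)
  then have gL: "f' x' \<in> L2 M" by (simp add: has_L2_derivative_def)
  have min: "L2_local_min_on M (\<lambda>x. f x + support_measure M x) (box_constraint M x\<^sub>a x\<^sub>b) x'"
    using \<open>L2_local_min_on M (\<lambda>x. f x + \<phi> x) \<Omega> x'\<close> unfolding \<phi>_def \<Omega>_def .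
  have bounds: "AE \<omega> in M. x' \<omega> \<noteq> 0 \<longrightarrow>
      (f' x' \<omega> > 0 \<longrightarrow> x' \<omega> = x\<^sub>a \<omega>) \<and> (f' x' \<omega> < 0 \<longrightarrow> x' \<omega> = x\<^sub>b \<omega>)"
    using local_min_at_bounds_on_support[OF der min \<open>x\<^sub>a \<in> L2 M\<close> \<open>x\<^sub>b \<in> L2 M\<close>] .
  obtain x1 where x1: "slowly_decreasing M x1" "x1 \<in> L2_ball M x' \<epsilon>"
      "\<bar>support_measure M x1 - support_measure M x'\<bar> < \<epsilon>"
    and x1_zero: "\<And>\<omega>. x' \<omega> = 0 \<Longrightarrow> x1 \<omega> = 0"
    using slowly_decreasing_approximation[OF \<open>x' \<in> L2 M\<close> \<epsilon>] by blast
  define x1s where "x1s = (\<lambda>\<omega>. if x' \<omega> = 0 then - f' x' \<omega> else 0)"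
  define x2s where "x2s = (\<lambda>\<omega>. if x' \<omega> = 0 then 0 else - f' x' \<omega>)"
  have [measurable]: "x' \<in> borel_measurable M" "f' x' \<in> borel_measurable M"
    using \<open>x' \<in> L2 M\<close> gL by (simp_all add: L2_def)
  have "x1s \<in> L2 M" "x2s \<in> L2 M"
    by (rule L2_dominated[OF gL], simp_all add: x1s_def x2s_def)+
  moreover have "(\<lambda>\<omega>. f' x' \<omega> + x1s \<omega> + x2s \<omega>) = (\<lambda>\<omega>. 0)"
    by (auto simp: x1s_def x2s_def)
  then have "L2_norm M (\<lambda>\<omega>. f' x' \<omega> + x1s \<omega> + x2s \<omega>) < \<epsilon>"
    using \<epsilon> by (simp add: L2_norm_def)
  moreover have "x' \<in> \<Omega> \<inter> L2_ball M x' \<epsilon>"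
    using min \<open>x' \<in> L2 M\<close> \<epsilon> by (simp add: L2_local_min_on_def \<Omega>_def L2_ball_def L2_norm_def)
  moreover have "AE \<omega> in M. x1s \<omega> \<noteq> 0 \<longrightarrow> x1 \<omega> = 0"
    using x1_zero by (auto simp: x1s_def)
  moreover have "AE \<omega> in M. x' \<omega> > x\<^sub>a \<omega> \<longrightarrow> x2s \<omega> \<ge> 0"
    using bounds by eventually_elim (auto simp: x2s_def intro: leI)
  moreover have "AE \<omega> in M. x' \<omega> < x\<^sub>b \<omega> \<longrightarrow> x2s \<omega> \<le> 0"
    using bounds by eventually_elim (auto simp: x2s_def intro: leI)
  ultimately show "\<exists>x1 x2 x1s x2s.
      slowly_decreasing M x1 \<and> x1 \<in> L2_ball M x' \<epsilon> \<and>
      x2 \<in> \<Omega> \<inter> L2_ball M x' \<epsilon> \<and>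
      x1s \<in> L2 M \<and> x2s \<in> L2 M \<and>
      L2_norm M (\<lambda>\<omega>. f' x2 \<omega> + x1s \<omega> + x2s \<omega>) < \<epsilon> \<and>
      \<bar>\<phi> x1 - \<phi> x'\<bar> < \<epsilon> \<and>
      (AE \<omega> in M. x1s \<omega> \<noteq> 0 \<longrightarrow> x1 \<omega> = 0) \<and>
      (AE \<omega> in M. x2 \<omega> > x\<^sub>a \<omega> \<longrightarrow> x2s \<omega> \<ge> 0) \<and>
      (AE \<omega> in M. x2 \<omega> < x\<^sub>b \<omega> \<longrightarrow> x2s \<omega> \<le> 0)"
    using x1 unfolding \<phi>_def by blast
qed

end
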